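(* Let $V_A,K,T,\lambda,\rho>0$ and $r\in\mathbb{R}$. Let $(X_t)_{t\ge0}$ be, under the risk-neutral measure $\mathbb{Q}$, the NegGamma process with rate $\lambda$ and shape $\rho$, i.e. the pure jump Lévy process with Lévy measure $\Pi_G(dx)=\rho\,\frac{e^{-\lambda|x|}}{|x|}\mathbf{1}_{\{x<0\}}\,dx$ and $\mathbb{E}^{\mathbb{Q}}[e^{iuX_t}]=e^{t\psi_G(u)}$, where $$\psi_G(u)=\int_{-\infty}^{+\infty}(e^{iux}-1)\,\Pi_G(dx)=-\rho\log\left(1+i\frac{u}{\lambda}\right).$$ Let $\omega_G:=\rho\log\left(1+\frac1\lambda\right)$, $V_A(T):=V_A\,e^{(r+\omega_G)T+X_T}$ and $$k_G:=\log\frac{V_A}{K}+\left(r+\rho\log\left(1+\frac1\lambda\right)\right)T .$$ Then the equity value $V_E:=e^{-rT}\,\mathbb{E}^{\mathbb{Q}}\left[\max(V_A(T)-K,0)\right]$ of the firm in the NegGamma credit risk model is $$V_E=\begin{cases} V_A\,\dfrac{\gamma(\rho T,(\lambda+1)k_G)}{\Gamma(\rho T)}-Ke^{-rT}\,\dfrac{\gamma(\rho T,\lambda k_G)}{\Gamma(\rho T)} & \text{if } k_G>0,\\[2mm] 0 & \text{if } k_G\le 0,\end{cases}$$ where $\gamma(a,z)=\int_0^z e^{-x}x^{a-1}\,dx$ is the lower incomplete gamma function and $\Gamma(a)$ is the gamma function.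
   Context: Structural credit risk setting: a firm has asset value $V_A(t)$, $t\in[0,T]$, with deterministic initial value $V_A:=V_A(0)>0$, and a zero-coupon debt of face value $K$ and maturity $T$; its equity at maturity is $\max(V_A(T)-K,0)$, and its equity value $V_E$ at time $0$ is the discounted $\mathbb{Q}$-expectation of this payoff, $r$ being the continuously compounded risk-free rate. The constant $\omega_G=-\psi_G(-i)$ is the martingale adjustment ensuring $\mathbb{E}^{\mathbb{Q}}[V_A(T)]=e^{rT}V_A$. A Lévy process is a càdlàg process with $X_0=0$ almost surely and independent, stationary increments. For $t>0$ the NegGamma process has density $f_G(x,t)=\frac{\lambda}{\Gamma(\rho t)}|\lambda x|^{\rho t-1}e^{-\lambda|x|}\mathbf{1}_{\{x<0\}}$. *)

theory Defs
  imports "HOL-Probability.Probability"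
begin

definition cadlag_on_nonneg :: "(real \<Rightarrow> real) \<Rightarrow> bool" where
  "cadlag_on_nonneg f \<longleftrightarrow>
     (\<forall>t\<ge>0. (f \<longlongrightarrow> f t) (at_right t)) \<and>
     (\<forall>t>0. \<exists>l. (f \<longlongrightarrow> l) (at_left t))"

text \<open>
  A process is a family \<open>X :: real \<Rightarrow> 'a \<Rightarrow> real\<close>, of which only the members at times \<open>t \<ge> 0\<close>
  are used.
\<close>

definition levy_process :: "'a measure \<Rightarrow> (real \<Rightarrow> 'a \<Rightarrow> real) \<Rightarrow> bool" where
  "levy_process M X \<longleftrightarrow>
     prob_space M \<and>
     (\<forall>t\<ge>0. X t \<in> borel_measurable M) \<and>
     (\<forall>\<omega>\<in>space M. cadlag_on_nonneg (\<lambda>t. X t \<omega>)) \<and>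
     (AE \<omega> in M. X 0 \<omega> = 0) \<and>
     (\<forall>(n::nat) (t :: nat \<Rightarrow> real). 0 \<le> t 0 \<and> (\<forall>i<n. t i < t (Suc i)) \<longrightarrow>
        prob_space.indep_vars M (\<lambda>_. borel) (\<lambda>i \<omega>. X (t (Suc i)) \<omega> - X (t i) \<omega>) {..<n}) \<and>
     (\<forall>s\<ge>0. \<forall>h\<ge>0.
        distr M borel (\<lambda>\<omega>. X (s + h) \<omega> - X s \<omega>) = distr M borel (\<lambda>\<omega>. X h \<omega> - X 0 \<omega>))"

definition levy_measure :: "real measure \<Rightarrow> bool" where
  "levy_measure \<nu> \<longleftrightarrow>
     sets \<nu> = sets borel \<and> emeasure \<nu> {0} = 0 \<and>
     (\<integral>\<^sup>+x. ennreal (min 1 (x\<^sup>2)) \<partial>\<nu>) < \<infinity>"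

text \<open>
  The Levy-Khintchine exponent of the triplet (drift \<open>b\<close>, Gaussian variance \<open>v\<close>, measure \<open>\<nu>\<close>),
  with truncation function \<open>x \<mapsto> x 1\<^bsub>\<bar>x\<bar> \<le> 1\<^esub>\<close>; the drift depends on this choice, \<open>v\<close> and \<open>\<nu>\<close>
  do not.
\<close>

definition levy_khintchine_exponent :: "real \<Rightarrow> real \<Rightarrow> real measure \<Rightarrow> real \<Rightarrow> complex" where
  "levy_khintchine_exponent b v \<nu> u =
     \<i> * of_real (b * u) - of_real (v * u\<^sup>2 / 2) +
     (CLINT x|\<nu>. iexp (u * x) - 1 - \<i> * of_real (u * x * indicator {-1..1} x))"

definition levy_process_with_triplet ::
    "'a measure \<Rightarrow> (real \<Rightarrow> 'a \<Rightarrow> real) \<Rightarrow> real \<Rightarrow> real \<Rightarrow> real measure \<Rightarrow> bool" where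
  "levy_process_with_triplet M X b v \<nu> \<longleftrightarrow>
     levy_process M X \<and> v \<ge> 0 \<and> levy_measure \<nu> \<and>
     (\<forall>t\<ge>0. \<forall>u. char (distr M borel (X t)) u = exp (of_real t * levy_khintchine_exponent b v \<nu> u))"

text \<open>Pure jump means that the Gaussian component of the triplet vanishes.\<close>

definition pure_jump_levy_process ::
    "'a measure \<Rightarrow> (real \<Rightarrow> 'a \<Rightarrow> real) \<Rightarrow> real measure \<Rightarrow> bool" where
  "pure_jump_levy_process M X \<nu> \<longleftrightarrow> (\<exists>b. levy_process_with_triplet M X b 0 \<nu>)"

definition neg_gamma_levy_measure :: "real \<Rightarrow> real \<Rightarrow> real measure" where
  "neg_gamma_levy_measure lam \<rho> =
     density lborel (\<lambda>x. ennreal (\<rho> * (exp (- lam * \<bar>x\<bar>) / \<bar>x\<bar>) * indicator {..<0} x))"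

definition neg_gamma_exponent :: "real \<Rightarrow> real \<Rightarrow> real \<Rightarrow> complex" where
  "neg_gamma_exponent lam \<rho> u = (CLINT x|neg_gamma_levy_measure lam \<rho>. iexp (u * x) - 1)"

text \<open>
  The second conjunct fixes the drift: it is the one for which the Levy-Khintchine exponent
  reduces to the uncompensated integral.
\<close>

definition neg_gamma_process ::
    "'a measure \<Rightarrow> real \<Rightarrow> real \<Rightarrow> (real \<Rightarrow> 'a \<Rightarrow> real) \<Rightarrow> bool" where
  "neg_gamma_process M lam \<rho> X \<longleftrightarrow>
     pure_jump_levy_process M X (neg_gamma_levy_measure lam \<rho>) \<and>
     (\<forall>t\<ge>0. \<forall>u. char (distr M borel (X t)) u = exp (of_real t * neg_gamma_exponent lam \<rho> u))"

definition neg_gamma_omega :: "real \<Rightarrow> real \<Rightarrow> real" where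
  "neg_gamma_omega lam \<rho> = \<rho> * ln (1 + 1 / lam)"

definition neg_gamma_asset_value ::
    "real \<Rightarrow> real \<Rightarrow> real \<Rightarrow> real \<Rightarrow> (real \<Rightarrow> 'a \<Rightarrow> real) \<Rightarrow> real \<Rightarrow> 'a \<Rightarrow> real" where
  "neg_gamma_asset_value V\<^sub>A r lam \<rho> X t \<omega> = V\<^sub>A * exp ((r + neg_gamma_omega lam \<rho>) * t + X t \<omega>)"

definition equity_payoff :: "real \<Rightarrow> ('a \<Rightarrow> real) \<Rightarrow> 'a \<Rightarrow> real" where
  "equity_payoff K V \<omega> = max (V \<omega> - K) 0"

definition equity_value :: "'a measure \<Rightarrow> real \<Rightarrow> real \<Rightarrow> real \<Rightarrow> ('a \<Rightarrow> real) \<Rightarrow> real" where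
  "equity_value M r K T V = exp (- r * T) * (\<integral>\<omega>. equity_payoff K V \<omega> \<partial>M)"

definition neg_gamma_k :: "real \<Rightarrow> real \<Rightarrow> real \<Rightarrow> real \<Rightarrow> real \<Rightarrow> real \<Rightarrow> real" where
  "neg_gamma_k V\<^sub>A K r T lam \<rho> = ln (V\<^sub>A / K) + (r + \<rho> * ln (1 + 1 / lam)) * T"

definition lower_inc_Gamma :: "real \<Rightarrow> real \<Rightarrow> real" where
  "lower_inc_Gamma a z = integral {0..z} (\<lambda>x. exp (- x) * x powr (a - 1))"

end

theory Submission
  imports Defs
begin

text \<open>
  Both \<open>u \<mapsto> neg_gamma_exponent\<close> and the characteristic function of the Gamma law are identified
  by differentiating in \<open>u\<close> under the integral. For the Levy measure the derivative removes the factor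
  \<open>1 / \<bar>x\<bar>\<close> and leaves an elementary exponential integral; for the Gamma law, integration by parts turns
  the derivative into the differential equation \<open>(lam - iu) \<phi>' = i a \<phi>\<close>. By Levy's uniqueness theorem
  \<open>- X T\<close> is then Gamma distributed with shape \<open>\<rho> T\<close>, and since the payoff is
  \<open>K max (exp (k + X T) - 1) 0\<close>, the expectation is an integral over \<open>{0..k}\<close> of two Gamma kernels
  of rates \<open>lam + 1\<close> and \<open>lam\<close>.
\<close>

section \<open>Differentiation of Fourier integrals under the integral sign\<close>

lemma norm_iexp_diff_le: "cmod (iexp x - iexp y) \<le> \<bar>x - y\<bar>"
proof -
  have "iexp x - iexp y = iexp y * (iexp (x - y) - 1)"
    by (simp add: algebra_simps flip: exp_add)
  then have "cmod (iexp x - iexp y) = cmod (iexp (x - y) - 1)"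
    by (simp add: norm_mult)
  also have "\<dots> \<le> \<bar>x - y\<bar>"
    using iexp_approx1[of "x - y" 0] by simp
  finally show ?thesis .
qed

lemma iexp_has_vector_derivative:
  "((\<lambda>u. iexp (u * x)) has_vector_derivative \<i> * of_real x * iexp (u * x)) (at u)"
proof -
  have "((\<lambda>z. exp (\<i> * (z * of_real x))) has_field_derivative \<i> * of_real x * iexp (u * x))
      (at (of_real u))"
    by (auto intro!: derivative_eq_intros)
  from has_vector_derivative_real_field[OF this] show ?thesis
    by simp
qed

text \<open>Dominated convergence for difference quotients: the first moment controls the increment,
  through the Lipschitz bound on \<open>iexp\<close>, and also its linear part. Subtracting 1 keeps
  the integrand integrable under an infinite measure, so the same result serves the Levy measure and
  the Gamma law.\<close>

lemma integral_iexp_has_vector_derivative: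
  fixes M :: "real measure"
  assumes sets[measurable_cong]: "sets M = sets borel" and int: "integrable M (\<lambda>x. x)"
  shows "((\<lambda>u. CLINT x|M. iexp (u * x) - 1) has_vector_derivative
    (CLINT x|M. \<i> * of_real x * iexp (u * x))) (at u)"
proof -
  have int1: "integrable M (\<lambda>x. iexp (v * x) - 1)" for v
  proof (rule Bochner_Integration.integrable_bound)
    show "integrable M (\<lambda>x. v * x)"
      using int by simp
    show "AE x in M. cmod (iexp (v * x) - 1) \<le> norm (v * x)"
      using norm_iexp_diff_le[of "v * x" 0 for x] by simp
  qed measurable
  have int2: "integrable M (\<lambda>x. \<i> * of_real x * iexp (u * x))"
    by (rule Bochner_Integration.integrable_bound[OF int]) (auto simp: norm_mult)
  have lim: "(\<lambda>h. norm ((CLINT x|M. iexp ((u + h) * x) - 1) - (CLINT x|M. iexp (u * x) - 1) -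
      h *\<^sub>R (CLINT x|M. \<i> * of_real x * iexp (u * x))) / norm h) \<midarrow>0\<rightarrow> 0"
    unfolding tendsto_at_iff_sequentially
  proof safe
    fix h :: "nat \<Rightarrow> real"
    assume h: "\<forall>i. h i \<in> UNIV - {0}" and h0: "h \<longlonglongrightarrow> 0"
    \<comment> \<open>The remainder of the first-order expansion at \<open>u\<close>, divided by the
      increment \<open>h n\<close>.\<close>
    define g where "g n x = (1 / h n) *\<^sub>R
      (iexp ((u + h n) * x) - iexp (u * x) - h n *\<^sub>R (\<i> * of_real x * iexp (u * x)))" for n x
    have [measurable]: "g n \<in> borel_measurable M" for n
      unfolding g_def by measurable
    have "(\<lambda>n. CLINT x|M. g n x) \<longlonglongrightarrow> (CLINT x|M. 0)"
    \<comment> \<open>One \<open>\<bar>x\<bar>\<close> bounds the difference quotient of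
      \<open>iexp\<close>, the other its derivative.\<close>
    proof (rule integral_dominated_convergence[where w = "\<lambda>x. 2 * \<bar>x\<bar>"])
      show "integrable M (\<lambda>x. 2 * \<bar>x\<bar>)"
        using int by simp
      show "AE x in M. (\<lambda>n. g n x) \<longlonglongrightarrow> 0"
      proof (rule AE_I2)
        fix x :: real
        have "(\<lambda>h. norm (iexp ((u + h) * x) - iexp (u * x) - h *\<^sub>R (\<i> * of_real x * iexp (u * x)))
            / norm h) \<midarrow>0\<rightarrow> 0"
          using iexp_has_vector_derivative[of x u]
          unfolding has_vector_derivative_def has_derivative_at by blast
        then have "(\<lambda>n. norm (iexp ((u + h n) * x) - iexp (u * x) -
            h n *\<^sub>R (\<i> * of_real x * iexp (u * x))) / norm (h n)) \<longlonglongrightarrow> 0"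
          using h h0 unfolding tendsto_at_iff_sequentially comp_def by blast
        then have "(\<lambda>n. norm (g n x)) \<longlonglongrightarrow> 0"
          unfolding g_def norm_scaleR by simp
        then show "(\<lambda>n. g n x) \<longlonglongrightarrow> 0"
          by (rule tendsto_norm_zero_cancel)
      qed
      show "AE x in M. norm (g n x) \<le> 2 * \<bar>x\<bar>" for n
      proof (rule AE_I2)
        fix x :: real
        have "norm (iexp ((u + h n) * x) - iexp (u * x) - h n *\<^sub>R (\<i> * of_real x * iexp (u * x)))
            \<le> \<bar>(u + h n) * x - u * x\<bar> + norm (h n *\<^sub>R (\<i> * of_real x * iexp (u * x)))"
          by (rule order_trans[OF norm_triangle_ineq4]) (intro add_right_mono norm_iexp_diff_le)
        also have "\<dots> = \<bar>h n\<bar> * (2 * \<bar>x\<bar>)"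
          by (simp add: norm_mult abs_mult algebra_simps)
        finally show "norm (g n x) \<le> 2 * \<bar>x\<bar>"
          using h unfolding g_def norm_scaleR by (simp add: divide_simps mult.commute)
      qed
    qed simp_all
    then have "(\<lambda>n. norm (CLINT x|M. g n x)) \<longlonglongrightarrow> 0"
      by (intro tendsto_norm_zero) simp
    moreover have "(CLINT x|M. g n x) = (1 / h n) *\<^sub>R
        ((CLINT x|M. iexp ((u + h n) * x) - 1) - (CLINT x|M. iexp (u * x) - 1) -
        h n *\<^sub>R (CLINT x|M. \<i> * of_real x * iexp (u * x)))" for n
    proof -
      have "g n x = (1 / h n) *\<^sub>R ((iexp ((u + h n) * x) - 1) - (iexp (u * x) - 1) -
          h n *\<^sub>R (\<i> * of_real x * iexp (u * x)))" for x
        by (simp add: g_def)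
      then show ?thesis
        by (simp only: integral_scaleR_right Bochner_Integration.integral_diff int1 int2 Bochner_Integration.integrable_diff
          integrable_scaleR_right)
    qed
    ultimately show "((\<lambda>h. norm ((CLINT x|M. iexp ((u + h) * x) - 1) - (CLINT x|M. iexp (u * x) - 1) -
        h *\<^sub>R (CLINT x|M. \<i> * of_real x * iexp (u * x))) / norm h) \<circ> h) \<longlonglongrightarrow> 0"
      by (simp add: comp_def)
  qed
  show ?thesis
    unfolding has_vector_derivative_def has_derivative_at
    using lim bounded_linear_scaleR_left by blast
qed

section \<open>Real and complex Gamma kernel integrals\<close>

lemma gamma_kernel_has_bochner_integral:
  fixes a s :: real
  assumes a: "a > 0" and s: "s > 0"
  shows "has_bochner_integral lborel (\<lambda>y. indicator {0<..} y * (y powr (a - 1) * exp (- s * y)))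
    (Gamma a / s powr a)"
proof -
  define g :: "real \<Rightarrow> real" where "g y = indicator {0<..} y * (y powr (a - 1) * exp (- y))" for y
  have [measurable]: "g \<in> borel_measurable borel"
    unfolding g_def by measurable
  have "(\<integral>\<^sup>+y. g y \<partial>lborel) = Gamma a"
  proof (rule nn_integral_has_integral_lborel)
    have "((\<lambda>t. t powr (a - 1) / exp t) has_integral Gamma a) {0..}"
      by (rule Gamma_integral_real[OF a])
    then have "((\<lambda>t. if t \<in> {0..} then t powr (a - 1) / exp t else 0) has_integral Gamma a) UNIV"
      by (subst has_integral_restrict_UNIV)
    then show "(g has_integral Gamma a) UNIV"
      by (rule has_integral_spike[where S = "{0}", rotated 2])
        (auto simp: g_def exp_minus field_simps indicator_def)
  qed (auto simp: g_def)
  then have "has_bochner_integral lborel g (Gamma a)"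
    using Gamma_real_pos[OF a] by (intro has_bochner_integral_nn_integral) (auto simp: g_def)
  \<comment> \<open>Rescaling by \<open>s\<close>; the factor
    \<open>inverse (s powr (a - 1))\<close> below cancels what \<open>(s * y) powr (a - 1)\<close>
    brings out.\<close>
  from lborel_has_bochner_integral_real_affine_iff[of s g "Gamma a" 0] this s
  have "has_bochner_integral lborel (\<lambda>y. g (s * y)) (Gamma a / s)"
    by (simp add: divide_inverse mult.commute)
  then have "has_bochner_integral lborel (\<lambda>y. inverse (s powr (a - 1)) * g (s * y))
      (inverse (s powr (a - 1)) * (Gamma a / s))"
    by (rule has_bochner_integral_mult_right)
  also have "(\<lambda>y. inverse (s powr (a - 1)) * g (s * y)) =
      (\<lambda>y. indicator {0<..} y * (y powr (a - 1) * exp (- s * y)))"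
    using s by (auto simp: g_def indicator_def powr_mult zero_less_mult_iff fun_eq_iff)
  also have "inverse (s powr (a - 1)) * (Gamma a / s) = Gamma a / s powr a"
    using s by (simp add: powr_diff field_simps)
  finally show ?thesis .
qed

text \<open>The exponential has modulus \<open>exp (- s * y)\<close>, so the real kernel
  dominates.\<close>

lemma complex_gamma_kernel_integrable:
  fixes a s u :: real
  assumes "a > 0" and "s > 0"
  shows "set_integrable lborel {0<..}
    (\<lambda>y. of_real (y powr (a - 1)) * exp (- ((of_real s + \<i> * of_real u) * of_real y)))"
  unfolding set_integrable_def
proof (rule Bochner_Integration.integrable_bound)
  show "integrable lborel (\<lambda>y. indicator {0<..} y * (y powr (a - 1) * exp (- s * y)))"
    using gamma_kernel_has_bochner_integral[OF assms] by (simp add: has_bochner_integral_iff)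
qed (auto simp: norm_mult indicator_def intro!: AE_I2)

lemma gamma_kernel_tendsto_0:
  fixes s :: real
  assumes "s > 0"
  shows "((\<lambda>y. y powr a * exp (- s * y)) \<longlongrightarrow> 0) at_top"
  using assms by real_asymp

text \<open>With \<open>z = s + \<i> * u\<close>, the primitive \<open>- exp (- (z * y)) / z\<close>
  equals \<open>- 1 / z\<close> at 0 and vanishes at infinity because \<open>s > 0\<close> is the
  real part of \<open>z\<close>.\<close>

lemma complex_gamma_kernel_integral_1:
  fixes s u :: real
  assumes s: "s > 0"
  shows "(s + \<i> * u) * (CLBINT y:{0<..}. exp (- ((of_real s + \<i> * of_real u) * of_real y))) = 1"
proof -
  define z where "z = s + \<i> * u"
  have z0: "z \<noteq> 0"
    using s by (auto simp: z_def complex_eq_iff)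
  have int: "set_integrable lborel {0<..} (\<lambda>y. exp (- (z * of_real y)))"
  proof -
    \<comment> \<open>The kernel of shape 1. Since \<open>0 powr 0 = 0\<close>, its power factor is
      1 only away from 0, as on this open half-line.\<close>
    have "set_integrable lborel {0<..} (\<lambda>y. of_real (y powr (1 - 1)) * exp (- (z * of_real y)))"
      unfolding z_def by (rule complex_gamma_kernel_integrable) (use s in auto)
    also have "?this \<longleftrightarrow> ?thesis"
      by (intro set_integrable_cong) auto
    finally show ?thesis .
  qed
  have nrm: "cmod (exp (- (z * of_real y))) = exp (- s * y)" for y
    by (simp add: z_def)
  have "(CLBINT y=ereal 0..\<infinity>. exp (- (z * of_real y))) = 0 - (- 1 / z)"
  proof (rule interval_integral_FTC_integrable[where F = "\<lambda>y. - exp (- (z * of_real y)) / z"])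
    fix y :: real
    have "((\<lambda>w. - exp (- (z * w)) / z) has_field_derivative exp (- (z * of_real y))) (at (of_real y))"
      using z0 by (auto intro!: derivative_eq_intros)
    from has_vector_derivative_real_field[OF this]
    show "((\<lambda>y. - exp (- (z * of_real y)) / z) has_vector_derivative exp (- (z * of_real y))) (at y)" .
    show "isCont (\<lambda>y. exp (- (z * of_real y))) y"
      by (intro continuous_intros)
  next
    have "((\<lambda>y. - exp (- (z * of_real y)) / z) \<longlongrightarrow> - exp (- (z * of_real 0)) / z) (at_right 0)"
      using z0 by (intro tendsto_intros)
    then show "(((\<lambda>y. - exp (- (z * of_real y)) / z) \<circ> real_of_ereal) \<longlongrightarrow> - 1 / z) (at_right (ereal 0))"
      by (simp add: ereal_tendsto_simps)
    have "((\<lambda>y. cmod (exp (- (z * of_real y)))) \<longlongrightarrow> 0) at_top"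
      unfolding nrm using s by real_asymp
    then have "((\<lambda>y. - exp (- (z * of_real y)) / z) \<longlongrightarrow> - 0 / z) at_top"
      using z0 by (intro tendsto_intros) (auto intro: tendsto_norm_zero_cancel)
    then show "(((\<lambda>y. - exp (- (z * of_real y)) / z) \<circ> real_of_ereal) \<longlongrightarrow> 0) (at_left \<infinity>)"
      by (simp add: ereal_tendsto_simps)
  qed (use int in auto)
  then show ?thesis
    using z0 by (simp add: interval_lebesgue_integral_def z_def)
qed

text \<open>Integration by parts against the boundary term \<open>y\<^sup>a e\<^bsup>-zy\<^esup>\<close>, which vanishes at both ends.\<close>

lemma complex_gamma_kernel_integral_Suc:
  fixes a s u :: real
  assumes a: "a > 0" and s: "s > 0"
  shows "(s + \<i> * u) *
      (CLBINT y:{0<..}. of_real (y powr a) * exp (- ((of_real s + \<i> * of_real u) * of_real y))) =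
    a * (CLBINT y:{0<..}. of_real (y powr (a - 1)) * exp (- ((of_real s + \<i> * of_real u) * of_real y)))"
proof -
  define z where "z = s + \<i> * u"
  define f where "f b y = of_real (y powr b) * exp (- (z * of_real y))" for b y :: real
  have int: "set_integrable lborel {0<..} (f a)" "set_integrable lborel {0<..} (f (a - 1))"
    using complex_gamma_kernel_integrable[of "a + 1" s u] complex_gamma_kernel_integrable[of a s u] a s
    by (simp_all add: f_def[abs_def] z_def)
  have nrm: "cmod (f a y) = y powr a * exp (- s * y)" for y
    by (simp add: z_def f_def norm_mult)
  have int': "set_integrable lborel {0<..} (\<lambda>y. a * f (a - 1) y - z * f a y)"
    using int by (intro set_integral_diff set_integrable_mult_right) auto
  have "(CLBINT y=ereal 0..\<infinity>. a * f (a - 1) y - z * f a y) = 0 - 0"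
  proof (rule interval_integral_FTC_integrable[where F = "f a"])
    fix y :: real assume "ereal 0 < ereal y"
    then have y: "y > 0" by simp
    from has_vector_derivative_of_real[OF has_real_derivative_powr[OF y, of a]]
    have 1: "((\<lambda>y. complex_of_real (y powr a)) has_vector_derivative of_real (a * y powr (a - 1))) (at y)" .
    have "((\<lambda>w. exp (- (z * w))) has_field_derivative - z * exp (- (z * of_real y))) (at (of_real y))"
      by (auto intro!: derivative_eq_intros)
    from has_vector_derivative_mult[OF 1 has_vector_derivative_real_field[OF this]]
    show "(f a has_vector_derivative a * f (a - 1) y - z * f a y) (at y)"
      unfolding f_def by (simp add: algebra_simps)
    show "isCont (\<lambda>y. a * f (a - 1) y - z * f a y) y"
      unfolding f_def using y by (intro continuous_intros) auto
  next
    \<comment> \<open>The limit is 0 because \<open>0 powr a = 0\<close>; continuity of the power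
      down to base 0 rests on \<open>a > 0\<close>.\<close>
    have "((\<lambda>y. cmod (f a y)) \<longlongrightarrow> 0 powr a * exp (- s * 0)) (at_right 0)"
      unfolding nrm using a by (intro tendsto_intros) (auto simp: eventually_at_right_less intro: eventually_at_rightI[of 0 1])
    then have "(f a \<longlongrightarrow> 0) (at_right 0)"
      by (auto intro: tendsto_norm_zero_cancel)
    then show "((f a \<circ> real_of_ereal) \<longlongrightarrow> 0) (at_right (ereal 0))"
      by (simp add: ereal_tendsto_simps)
    have "((\<lambda>y. cmod (f a y)) \<longlongrightarrow> 0) at_top"
      unfolding nrm by (rule gamma_kernel_tendsto_0[OF s])
    then have "(f a \<longlongrightarrow> 0) at_top"
      by (rule tendsto_norm_zero_cancel)
    then show "((f a \<circ> real_of_ereal) \<longlongrightarrow> 0) (at_left \<infinity>)"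
      by (simp add: ereal_tendsto_simps)
  qed (use int' in auto)
  then have "a * (CLBINT y:{0<..}. f (a - 1) y) - z * (CLBINT y:{0<..}. f a y) = 0"
    using int by (simp add: interval_lebesgue_integral_def set_integral_diff set_integrable_mult_right)
  then show ?thesis
    unfolding f_def z_def by simp
qed

section \<open>Closed form of the Levy exponent\<close>

lemma one_plus_imaginary_notin_nonpos_Reals: "1 + \<i> * of_real v \<notin> \<real>\<^sub>\<le>\<^sub>0"
  by (auto simp: complex_nonpos_Reals_iff)

text \<open>The argument of \<open>Ln\<close> has real part 1 and so avoids the branch cut. Both
  signs of \<open>c\<close> occur: \<open>lam\<close> for the Levy exponent, \<open>- lam\<close>
  for the Gamma law.\<close>

lemma Ln_one_plus_imaginary_has_vector_derivative:
  fixes c :: real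
  assumes "c \<noteq> 0"
  shows "((\<lambda>u. Ln (1 + \<i> * of_real (u / c))) has_vector_derivative \<i> / (c + \<i> * u)) (at u)"
proof -
  have "((\<lambda>z. Ln (1 + \<i> * (z / of_real c))) has_field_derivative
      inverse (1 + \<i> * (of_real u / of_real c)) * (\<i> / of_real c)) (at (of_real u))"
    using assms one_plus_imaginary_notin_nonpos_Reals[of "u / c"]
    by (auto intro!: derivative_eq_intros)
  moreover have "inverse (1 + \<i> * (of_real u / of_real c)) * (\<i> / of_real c) = \<i> / (c + \<i> * u)"
    using assms by (simp add: inverse_eq_divide distrib_right)
  ultimately show ?thesis
    using has_vector_derivative_real_field by fastforce
qed

lemma has_vector_derivative_zero_imp_eq:
  fixes f :: "real \<Rightarrow> 'b::real_normed_vector"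
  assumes "\<And>u. (f has_vector_derivative 0) (at u)"
  shows "f u = f v"
proof -
  obtain c where "\<And>x. f x = c"
    using has_derivative_zero_constant[of UNIV f] assms
    by (auto simp: has_vector_derivative_def)
  then show ?thesis by simp
qed

text \<open>Both sides vanish at \<open>u = 0\<close> and have the derivative
  \<open>- \<i> * \<rho> / (lam + \<i> * u)\<close>.\<close>

lemma neg_gamma_exponent_eq:
  assumes lam: "lam > 0" and rho: "\<rho> > 0"
  shows "neg_gamma_exponent lam \<rho> u = - of_real \<rho> * Ln (1 + \<i> * of_real (u / lam))"
proof -
  define d where "d x = \<rho> * (exp (- lam * \<bar>x\<bar>) / \<bar>x\<bar>) * indicator {..<0} x" for x :: real
  have [measurable]: "d \<in> borel_measurable borel"
    unfolding d_def by measurable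
  have d_nonneg: "AE x in lborel. 0 \<le> d x"
    using rho by (simp add: d_def)
  define M where "M = neg_gamma_levy_measure lam \<rho>"
  have M: "M = density lborel (\<lambda>x. ennreal (d x))"
    unfolding M_def neg_gamma_levy_measure_def d_def ..
  have sets: "sets M = sets borel"
    by (simp add: M)
  have int: "integrable M (\<lambda>x. x)"
  proof -
    \<comment> \<open>After reflection, \<open>x\<close> times the Levy density is
      \<open>- \<rho>\<close> times the kernel of shape 1, so the first moment is finite.\<close>
    have "integrable lborel (\<lambda>y. - \<rho> * (indicator {0<..} y * (y powr (1 - 1) * exp (- lam * y))))"
      using gamma_kernel_has_bochner_integral[of 1 lam] lam
      by (intro integrable_mult_right) (simp add: has_bochner_integral_iff)
    also have "(\<lambda>y. - \<rho> * (indicator {0<..} y * (y powr (1 - 1) * exp (- lam * y)))) =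
        (\<lambda>y. d (0 + - 1 * y) *\<^sub>R (0 + - 1 * y))"
      by (auto simp: d_def indicator_def fun_eq_iff)
    finally have "integrable lborel (\<lambda>x. d x *\<^sub>R x)"
      by (subst (asm) lborel_integrable_real_affine_iff) auto
    then show ?thesis
      unfolding M by (subst integrable_density) (auto simp: d_nonneg)
  qed
  have deriv: "(CLINT x|M. \<i> * of_real x * iexp (v * x)) = - \<i> * \<rho> / (lam + \<i> * v)" for v
  proof -
    have "(CLINT x|M. \<i> * of_real x * iexp (v * x)) =
        (CLINT x|lborel. d x *\<^sub>R (\<i> * of_real x * iexp (v * x)))"
      unfolding M by (subst integral_density) (auto simp: d_nonneg)
    \<comment> \<open>Reflection to the positive half-line, written as an affine map with shift 0
      and slope \<open>- 1\<close>; the factor \<open>x\<close> then cancels the singularity of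
      \<open>d\<close>.\<close>
    also have "\<dots> = (CLINT y|lborel. d (0 + - 1 * y) *\<^sub>R
        (\<i> * of_real (0 + - 1 * y) * iexp (v * (0 + - 1 * y))))"
      by (subst lborel_integral_real_affine[where c = "- 1" and t = 0]) auto
    also have "\<dots> = (CLBINT y:{0<..}. (- \<i> * \<rho>) * exp (- ((of_real lam + \<i> * of_real v) * of_real y)))"
      unfolding set_lebesgue_integral_def
      by (intro Bochner_Integration.integral_cong)
        (auto simp: d_def indicator_def scaleR_conv_of_real exp_of_real[symmetric] ring_distribs
          exp_add exp_diff exp_minus field_simps)
    also have "\<dots> = (- \<i> * \<rho>) * (CLBINT y:{0<..}. exp (- ((of_real lam + \<i> * of_real v) * of_real y)))"
      by (rule set_integral_mult_right)
    also have "\<dots> = - \<i> * \<rho> / (lam + \<i> * v)"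
      using complex_gamma_kernel_integral_1[OF lam, of v] lam
      by (simp add: complex_eq_iff[of _ 0] field_simps)
    finally show ?thesis .
  qed
  have "((\<lambda>v. neg_gamma_exponent lam \<rho> v + of_real \<rho> * Ln (1 + \<i> * of_real (v / lam)))
      has_vector_derivative 0) (at v)" for v
  proof -
    have "((\<lambda>v. neg_gamma_exponent lam \<rho> v + of_real \<rho> * Ln (1 + \<i> * of_real (v / lam)))
        has_vector_derivative (- \<i> * \<rho> / (lam + \<i> * v) + \<rho> * (\<i> / (lam + \<i> * v)))) (at v)"
      unfolding neg_gamma_exponent_def M_def[symmetric] deriv[symmetric] using lam
      by (intro has_vector_derivative_add integral_iexp_has_vector_derivative
        has_vector_derivative_mult_right Ln_one_plus_imaginary_has_vector_derivative sets int) auto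
    then show ?thesis by simp
  qed
  from has_vector_derivative_zero_imp_eq[OF this, of u 0]
  show ?thesis
    by (simp add: neg_gamma_exponent_def add_eq_0_iff2)
qed

section \<open>The Gamma law and its characteristic function\<close>

definition gamma_density :: "real \<Rightarrow> real \<Rightarrow> real \<Rightarrow> real" where
  "gamma_density lam a y =
    lam powr a / Gamma a * (indicator {0<..} y * (y powr (a - 1) * exp (- lam * y)))"

text \<open>For \<open>a = \<rho> * t\<close> this is the mirror image, on the positive half-line,
  of the NegGamma law at time \<open>t\<close>.\<close>

definition gamma_law :: "real \<Rightarrow> real \<Rightarrow> real measure" where
  "gamma_law lam a = density lborel (\<lambda>y. ennreal (gamma_density lam a y))"

lemma gamma_density_measurable [measurable]: "gamma_density lam a \<in> borel_measurable borel"
  unfolding gamma_density_def[abs_def] by measurable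

lemma gamma_density_nonneg: "a > 0 \<Longrightarrow> gamma_density lam a y \<ge> 0"
  using Gamma_real_pos[of a] by (simp add: gamma_density_def)

lemma gamma_density_has_bochner_integral:
  assumes "lam > 0" and "a > 0"
  shows "has_bochner_integral lborel (gamma_density lam a) 1"
proof -
  have "has_bochner_integral lborel (gamma_density lam a)
      (lam powr a / Gamma a * (Gamma a / lam powr a))"
    unfolding gamma_density_def
    by (intro has_bochner_integral_mult_right gamma_kernel_has_bochner_integral assms)
  then show ?thesis
    using assms Gamma_real_pos[of a] by (auto simp: less_le split: if_splits)
qed

lemma real_distribution_gamma_law:
  assumes "lam > 0" and "a > 0"
  shows "real_distribution (gamma_law lam a)"
proof -
  have "emeasure (gamma_law lam a) (space (gamma_law lam a)) =
      (\<integral>\<^sup>+y. ennreal (gamma_density lam a y) \<partial>lborel)"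
    by (simp add: gamma_law_def emeasure_density)
  also have "\<dots> = ennreal 1"
    using gamma_density_has_bochner_integral[OF assms] gamma_density_nonneg[OF assms(2)]
    by (subst nn_integral_eq_integral) (auto simp: has_bochner_integral_iff)
  finally have "prob_space (gamma_law lam a)"
    by (intro prob_spaceI) simp
  then show ?thesis
    by (simp add: real_distribution_def real_distribution_axioms_def gamma_law_def)
qed

text \<open>The characteristic function solves a linear differential equation, and the reciprocal of
  the claimed value solves the one with opposite sign; hence their product is constant, equal to 1
  at 0. The argument \<open>- u / lam\<close> matches the NegGamma exponent at \<open>- u\<close>,
  as the reflection of the process requires.\<close>

lemma char_gamma_law:
  assumes lam: "lam > 0" and a: "a > 0"
  shows "char (gamma_law lam a) u = exp (- of_real a * Ln (1 + \<i> * of_real (- u / lam)))"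
proof -
  interpret real_distribution "gamma_law lam a"
    by (rule real_distribution_gamma_law[OF assms])
  define C where "C = lam powr a / Gamma a"
  \<comment> \<open>This is \<open>lam - \<i> * v\<close>, in the shape \<open>s + \<i> * u\<close>
    of the kernel lemmas.\<close>
  define z where "z v = lam + \<i> * of_real (- v)" for v
  have z0: "z v \<noteq> 0" for v
    using lam by (auto simp: z_def complex_eq_iff)
  \<comment> \<open>Up to constants, \<open>F (a - 1)\<close> is the characteristic function and
    \<open>F a\<close> its derivative; the recursion \<open>F_rec\<close> links them.\<close>
  define F where "F b v = (CLBINT y:{0<..}. of_real (y powr b) * exp (- (z v * of_real y)))" for b v
  have F_rec: "z v * F a v = a * F (a - 1) v" for v
    unfolding F_def z_def of_real_add of_real_mult by (rule complex_gamma_kernel_integral_Suc[OF a lam])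
  have dens: "(CLINT y|gamma_law lam a. f y) = (CLINT y|lborel. gamma_density lam a y *\<^sub>R f y)"
    if "f \<in> borel_measurable borel" for f :: "real \<Rightarrow> complex"
    unfolding gamma_law_def using that gamma_density_nonneg[OF a]
    by (subst integral_density) auto
  have char_F: "char (gamma_law lam a) v = C * F (a - 1) v" for v
  proof -
    have "char (gamma_law lam a) v = (CLINT y|lborel. gamma_density lam a y *\<^sub>R iexp (v * y))"
      unfolding char_def by (rule dens) simp
    also have "\<dots> = (CLBINT y:{0<..}. of_real C * (of_real (y powr (a - 1)) * exp (- (z v * of_real y))))"
      unfolding set_lebesgue_integral_def C_def z_def
      by (intro Bochner_Integration.integral_cong)
        (auto simp: gamma_density_def indicator_def scaleR_conv_of_real exp_of_real[symmetric]
          ring_distribs exp_add exp_diff exp_minus field_simps)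
    also have "\<dots> = C * F (a - 1) v"
      unfolding F_def by (rule set_integral_mult_right)
    finally show ?thesis .
  qed
  have deriv_F: "(CLINT y|gamma_law lam a. \<i> * of_real y * iexp (v * y)) = \<i> * C * F a v" for v
  proof -
    have "(CLINT y|gamma_law lam a. \<i> * of_real y * iexp (v * y)) =
        (CLINT y|lborel. gamma_density lam a y *\<^sub>R (\<i> * of_real y * iexp (v * y)))"
      by (rule dens) simp
    also have "\<dots> = (CLBINT y:{0<..}. (\<i> * C) * (of_real (y powr a) * exp (- (z v * of_real y))))"
      unfolding set_lebesgue_integral_def C_def z_def
      by (intro Bochner_Integration.integral_cong)
        (auto simp: gamma_density_def indicator_def scaleR_conv_of_real exp_of_real[symmetric]
          ring_distribs exp_add exp_diff exp_minus field_simps powr_diff)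
    also have "\<dots> = \<i> * C * F a v"
      unfolding F_def by (rule set_integral_mult_right)
    finally show ?thesis .
  qed
  have int: "integrable (gamma_law lam a) (\<lambda>y. y)"
  proof -
    \<comment> \<open>The first moment is a kernel integral of shape \<open>a + 1\<close>.\<close>
    have "integrable lborel (\<lambda>y. C * (indicator {0<..} y * (y powr (a + 1 - 1) * exp (- lam * y))))"
      using gamma_kernel_has_bochner_integral[of "a + 1" lam] lam a
      by (intro integrable_mult_right) (simp add: has_bochner_integral_iff)
    also have "(\<lambda>y. C * (indicator {0<..} y * (y powr (a + 1 - 1) * exp (- lam * y)))) =
        (\<lambda>y. gamma_density lam a y *\<^sub>R y)"
      by (auto simp: gamma_density_def C_def indicator_def fun_eq_iff powr_diff)
    finally show ?thesis
      unfolding gamma_law_def using gamma_density_nonneg[OF a]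
      by (subst integrable_density) auto
  qed
  have d_char: "(char (gamma_law lam a) has_vector_derivative
      \<i> * a / z v * char (gamma_law lam a) v) (at v)" for v
  proof -
    have int_char: "integrable (gamma_law lam a) (\<lambda>y. iexp (v * y))" for v
      by (rule integrable_const_bound[where B = 1]) auto
    \<comment> \<open>Total mass 1 turns the subtracted 1 into a constant, which does not affect the
      derivative.\<close>
    have "(CLINT y|gamma_law lam a. iexp (v * y) - 1) = char (gamma_law lam a) v - 1" for v
      unfolding char_def using int_char[of v] prob_space
      by (subst Bochner_Integration.integral_diff) auto
    then have "((\<lambda>v. char (gamma_law lam a) v - 1 + 1) has_vector_derivative \<i> * C * F a v + 0) (at v)"
      using integral_iexp_has_vector_derivative[OF _ int, of v] unfolding deriv_F
      by (intro has_vector_derivative_add) auto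
    also have "\<i> * C * F a v + 0 = \<i> * a / z v * char (gamma_law lam a) v"
      using F_rec[of v] z0[of v] unfolding char_F by (simp add: field_simps)
    finally show ?thesis by simp
  qed
  \<comment> \<open>The reciprocal of the claimed characteristic function, with
    \<open>v / - lam\<close> so that the logarithm is differentiated with
    \<open>c = - lam\<close>.\<close>
  define E where "E v = exp (of_real a * Ln (1 + \<i> * of_real (v / - lam)))" for v
  have d_E: "(E has_vector_derivative - \<i> * a / z v * E v) (at v)" for v
  proof -
    have "((\<lambda>v. of_real a * Ln (1 + \<i> * of_real (v / - lam))) has_vector_derivative
        of_real a * (\<i> / (of_real (- lam) + \<i> * v))) (at v)"
      using lam by (intro has_vector_derivative_mult_right Ln_one_plus_imaginary_has_vector_derivative) auto
    from field_vector_diff_chain_at[OF this DERIV_exp]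
    have "(E has_vector_derivative of_real a * (\<i> / (of_real (- lam) + \<i> * v)) * E v) (at v)"
      unfolding E_def[abs_def] comp_def .
    moreover have "\<i> / (of_real (- lam) + \<i> * v) = - \<i> / z v"
      by (simp add: z_def minus_divide_right)
    ultimately have "(E has_vector_derivative of_real a * (- \<i> / z v) * E v) (at v)"
      by (simp only:)
    then show ?thesis by (simp add: mult.commute)
  qed
  have "((\<lambda>v. char (gamma_law lam a) v * E v) has_vector_derivative 0) (at v)" for v
    using has_vector_derivative_mult[OF d_char d_E, of v] by (simp add: algebra_simps)
  from has_vector_derivative_zero_imp_eq[OF this, of u 0]
  have "char (gamma_law lam a) u * E u = 1"
    by (simp add: E_def char_zero)
  then show ?thesis
    by (simp add: E_def exp_minus field_simps)
qed

section \<open>Law of the reflected process at a fixed time\<close>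

lemma distr_uminus_neg_gamma_process:
  assumes lam: "lam > 0" and rho: "\<rho> > 0" and t: "t > 0" and X: "neg_gamma_process M lam \<rho> X"
  shows "X t \<in> borel_measurable M"
    and "distr M borel (\<lambda>\<omega>. - X t \<omega>) = gamma_law lam (\<rho> * t)"
proof -
  have "levy_process M X"
    using X by (auto simp: neg_gamma_process_def pure_jump_levy_process_def levy_process_with_triplet_def)
  then interpret prob_space M
    by (simp add: levy_process_def)
  show meas[measurable]: "X t \<in> borel_measurable M"
    using \<open>levy_process M X\<close> t by (simp add: levy_process_def)
  show "distr M borel (\<lambda>\<omega>. - X t \<omega>) = gamma_law lam (\<rho> * t)"
  proof (rule Levy_uniqueness)
    show "real_distribution (distr M borel (\<lambda>\<omega>. - X t \<omega>))"
      by (rule real_distribution_distr) simp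
    show "real_distribution (gamma_law lam (\<rho> * t))"
      using assms by (intro real_distribution_gamma_law) auto
    show "char (distr M borel (\<lambda>\<omega>. - X t \<omega>)) = char (gamma_law lam (\<rho> * t))"
    proof
      fix u
      have "char (distr M borel (\<lambda>\<omega>. - X t \<omega>)) u = char (distr M borel (X t)) (- u)"
        unfolding char_def by (simp add: integral_distr)
      also have "\<dots> = exp (of_real t * neg_gamma_exponent lam \<rho> (- u))"
        using X t unfolding neg_gamma_process_def by simp
      \<comment> \<open>In closed form, \<open>t\<close> times the exponent at \<open>- u\<close> is
        \<open>- \<rho> * t\<close> times the logarithm in the Gamma characteristic function, whence
        the shape \<open>\<rho> * t\<close>.\<close>
      also have "\<dots> = char (gamma_law lam (\<rho> * t)) u"
        using assms by (subst char_gamma_law) (auto simp: neg_gamma_exponent_eq algebra_simps)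
      finally show "char (distr M borel (\<lambda>\<omega>. - X t \<omega>)) u = char (gamma_law lam (\<rho> * t)) u" .
    qed
  qed
qed

section \<open>Expectation of the payoff under the Gamma law\<close>

lemma lower_inc_Gamma_has_bochner_integral:
  fixes a s k :: real
  assumes a: "a > 0" and s: "s > 0"
  shows "has_bochner_integral lborel (\<lambda>y. indicator {0..k} y * (y powr (a - 1) * exp (- s * y)))
    (lower_inc_Gamma a (s * k) / s powr a)"
proof -
  define g :: "real \<Rightarrow> real" where "g y = indicator {0..s * k} y * (y powr (a - 1) * exp (- y))" for y
  have [measurable]: "g \<in> borel_measurable borel"
    unfolding g_def by measurable
  have g_int: "integrable lborel g"
  proof (rule Bochner_Integration.integrable_bound)
    \<comment> \<open>The kernel on the open half-line dominates even at the endpoint 0, where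
      \<open>g\<close> is 0 because \<open>0 powr (a - 1) = 0\<close>.\<close>
    show "integrable lborel (\<lambda>y. indicator {0<..} y * (y powr (a - 1) * exp (- 1 * y)))"
      using gamma_kernel_has_bochner_integral[OF a, of 1] by (simp add: has_bochner_integral_iff)
  qed (auto simp: g_def indicator_def intro!: AE_I2)
  have "set_integrable lborel {0..s * k} (\<lambda>y. exp (- y) * y powr (a - 1))"
    using g_int by (simp add: set_integrable_def g_def[abs_def] mult.commute)
  from set_borel_integral_eq_integral(2)[OF this]
  have "(\<integral>y. g y \<partial>lborel) = lower_inc_Gamma a (s * k)"
    by (simp add: lower_inc_Gamma_def set_lebesgue_integral_def g_def mult.commute)
  with g_int have "has_bochner_integral lborel g (lower_inc_Gamma a (s * k))"
    by (simp add: has_bochner_integral_iff)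
  with lborel_has_bochner_integral_real_affine_iff[of s g "lower_inc_Gamma a (s * k)" 0] s
  have "has_bochner_integral lborel (\<lambda>y. g (s * y)) (lower_inc_Gamma a (s * k) / s)"
    by (simp add: divide_inverse mult.commute)
  then have "has_bochner_integral lborel (\<lambda>y. inverse (s powr (a - 1)) * g (s * y))
      (inverse (s powr (a - 1)) * (lower_inc_Gamma a (s * k) / s))"
    by (rule has_bochner_integral_mult_right)
  also have "(\<lambda>y. inverse (s powr (a - 1)) * g (s * y)) =
      (\<lambda>y. indicator {0..k} y * (y powr (a - 1) * exp (- s * y)))"
    using s by (auto simp: g_def indicator_def powr_mult zero_le_mult_iff fun_eq_iff)
  also have "inverse (s powr (a - 1)) * (lower_inc_Gamma a (s * k) / s) =
      lower_inc_Gamma a (s * k) / s powr a"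
    using s by (simp add: powr_diff field_simps)
  finally show ?thesis .
qed

text \<open>On the support the payoff is nonzero only for \<open>y < k\<close>, where it is
  \<open>exp (k - y) - 1\<close>. The factor \<open>exp (- y)\<close> raises the rate from
  \<open>lam\<close> to \<open>lam + 1\<close>, and normalizing the resulting kernel with
  \<open>lam powr a\<close> leaves \<open>(lam / (lam + 1)) powr a\<close>.\<close>

lemma gamma_law_call_has_bochner_integral:
  fixes k lam a :: real
  assumes lam: "lam > 0" and a: "a > 0"
  shows "has_bochner_integral (gamma_law lam a) (\<lambda>y. max (exp (k - y) - 1) 0)
    (if k > 0 then exp k * (lam / (lam + 1)) powr a * (lower_inc_Gamma a ((lam + 1) * k) / Gamma a)
       - lower_inc_Gamma a (lam * k) / Gamma a
     else 0)"
proof -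
  define C where "C = lam powr a / Gamma a"
  define I where "I s = lower_inc_Gamma a (s * k) / s powr a" for s
  define g where "g s y = indicator {0..k} y * (y powr (a - 1) * exp (- s * y))" for s y :: real
  define R where "R = (if k > 0 then C * exp k * I (lam + 1) - C * I lam else 0)"
  have "has_bochner_integral lborel (\<lambda>y. gamma_density lam a y * max (exp (k - y) - 1) 0) R"
  proof (cases "k > 0")
    case True
    have g: "has_bochner_integral lborel (g s) (I s)" if "s > 0" for s
      unfolding g_def I_def by (rule lower_inc_Gamma_has_bochner_integral[OF a that])
    have "has_bochner_integral lborel (\<lambda>y. C * exp k * g (lam + 1) y - C * g lam y)
        (C * exp k * I (lam + 1) - C * I lam)"
      using lam by (intro has_bochner_integral_diff has_bochner_integral_mult_right g) auto
    then have "has_bochner_integral lborel (\<lambda>y. C * exp k * g (lam + 1) y - C * g lam y) R"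
      using True by (simp add: R_def)
    also have "(\<lambda>y. C * exp k * g (lam + 1) y - C * g lam y) =
        (\<lambda>y. gamma_density lam a y * max (exp (k - y) - 1) 0)"
    proof
      fix y
      have "exp k * exp (- (lam + 1) * y) = exp (- lam * y) * exp (k - y)"
        by (simp add: algebra_simps flip: exp_add)
      then have "C * exp k * g (lam + 1) y - C * g lam y = C * (indicator {0..k} y *
          (y powr (a - 1) * (exp (- lam * y) * exp (k - y) - exp (- lam * y))))"
        unfolding g_def by algebra
      also have "\<dots> = gamma_density lam a y * max (exp (k - y) - 1) 0"
        by (auto simp: gamma_density_def C_def indicator_def max_def right_diff_distrib diff_divide_distrib mult.assoc)
      finally show "C * exp k * g (lam + 1) y - C * g lam y =
          gamma_density lam a y * max (exp (k - y) - 1) 0" .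
    qed
    finally show ?thesis .
  next
    case False
    \<comment> \<open>For \<open>k \<le> 0\<close> the exponential stays below 1 on the support
      \<open>y > 0\<close>.\<close>
    then have "(\<lambda>y. gamma_density lam a y * max (exp (k - y) - 1) 0) = (\<lambda>_. 0)"
      by (auto simp: gamma_density_def indicator_def fun_eq_iff)
    with False show ?thesis
      by (simp add: R_def has_bochner_integral_zero)
  qed
  then have "has_bochner_integral (gamma_law lam a) (\<lambda>y. max (exp (k - y) - 1) 0) R"
    unfolding gamma_law_def using gamma_density_nonneg[OF a]
    by (intro has_bochner_integral_density) auto
  also have "R = (if k > 0 then
      exp k * (lam / (lam + 1)) powr a * (lower_inc_Gamma a ((lam + 1) * k) / Gamma a)
        - lower_inc_Gamma a (lam * k) / Gamma a
      else 0)"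
    using lam by (simp add: R_def C_def I_def powr_divide mult.commute)
  finally show ?thesis .
qed

section \<open>Equity value in the NegGamma model\<close>

theorem proposition3p1:
  fixes Q :: "'a measure" and X :: "real \<Rightarrow> 'a \<Rightarrow> real"
    and V\<^sub>A K T lam \<rho> r :: real
  assumes "V\<^sub>A > 0" and "K > 0" and "T > 0" and "lam > 0" and "\<rho> > 0"
    and "neg_gamma_process Q lam \<rho> X"
  shows "(\<forall>u. neg_gamma_exponent lam \<rho> u = - of_real \<rho> * Ln (1 + \<i> * of_real (u / lam))) \<and>
    integrable Q (equity_payoff K (neg_gamma_asset_value V\<^sub>A r lam \<rho> X T)) \<and>
    equity_value Q r K T (neg_gamma_asset_value V\<^sub>A r lam \<rho> X T) =
      (let k = neg_gamma_k V\<^sub>A K r T lam \<rho> in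
        if k > 0 then
          V\<^sub>A * (lower_inc_Gamma (\<rho> * T) ((lam + 1) * k) / Gamma (\<rho> * T))
          - K * exp (- r * T) * (lower_inc_Gamma (\<rho> * T) (lam * k) / Gamma (\<rho> * T))
        else 0)"
proof -
  define a where "a = \<rho> * T"
  define k where "k = neg_gamma_k V\<^sub>A K r T lam \<rho>"
  define P where "P = equity_payoff K (neg_gamma_asset_value V\<^sub>A r lam \<rho> X T)"
  \<comment> \<open>The payoff as a function of \<open>y = - X T\<close>.\<close>
  define h where "h y = K * max (exp (k - y) - 1) 0" for y :: real
  define G where "G s = lower_inc_Gamma a (s * k) / Gamma a" for s
  define R where "R = K * (if k > 0 then exp k * (lam / (lam + 1)) powr a * G (lam + 1) - G lam else 0)"
  have a: "a > 0"
    using assms by (simp add: a_def)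
  have exp_k: "K * exp k = V\<^sub>A * exp (r * T) * (1 + 1 / lam) powr a"
  proof -
    have "1 + 1 / lam > 0"
      using assms by (simp add: add_pos_pos)
    then show ?thesis
      using assms unfolding k_def neg_gamma_k_def a_def
      by (simp add: exp_add powr_def algebra_simps)
  qed
  have [measurable]: "h \<in> borel_measurable borel"
    unfolding h_def by measurable
  \<comment> \<open>By the choice of \<open>k\<close>, the deterministic part of the asset value at
    \<open>T\<close> is \<open>K * exp k\<close>.\<close>
  have P: "P \<omega> = h (- X T \<omega>)" for \<omega>
  proof -
    have "V\<^sub>A * exp ((r + neg_gamma_omega lam \<rho>) * T + X T \<omega>) = K * exp (k + X T \<omega>)"
      using assms by (simp add: k_def neg_gamma_k_def neg_gamma_omega_def exp_add)
    then show ?thesis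
      using assms by (simp add: P_def h_def equity_payoff_def neg_gamma_asset_value_def
        max_mult_distrib_left algebra_simps)
  qed
  have X[measurable]: "X T \<in> borel_measurable Q"
    and distr: "distr Q borel (\<lambda>\<omega>. - X T \<omega>) = gamma_law lam a"
    using distr_uminus_neg_gamma_process[OF assms(4,5,3,6)] unfolding a_def by auto
  have "has_bochner_integral (gamma_law lam a) h R"
    using gamma_law_call_has_bochner_integral[OF assms(4) a, of k]
    unfolding h_def R_def G_def by (rule has_bochner_integral_mult_right)
  then have "has_bochner_integral Q P R"
    unfolding distr[symmetric] has_bochner_integral_iff
    by (simp add: integrable_distr_eq integral_distr P[abs_def])
  \<comment> \<open>Integrability makes the integral a genuine expectation rather than the default
    value 0.\<close>
  then have int: "integrable Q P" and val: "(\<integral>\<omega>. P \<omega> \<partial>Q) = R"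
    by (auto simp: has_bochner_integral_iff)
  \<comment> \<open>The martingale adjustment contributes \<open>(1 + 1 / lam) powr a\<close>, the
    inverse of \<open>(lam / (lam + 1)) powr a\<close>, which is the expectation of
    \<open>exp (X T)\<close>; discounting removes \<open>exp (r * T)\<close>.\<close>
  have "exp (- r * T) * (K * exp k) * (lam / (lam + 1)) powr a = V\<^sub>A"
  proof -
    have "(1 + 1 / lam) powr a * (lam / (lam + 1)) powr a = 1"
    proof -
      have "1 + 1 / lam = (lam + 1) / lam"
        using assms by (simp add: field_simps)
      then show ?thesis
        using assms by (simp flip: powr_mult)
    qed
    then show ?thesis
      unfolding exp_k by (simp add: exp_minus field_simps)
  qed
  then have "exp (- r * T) * R = (if k > 0 then V\<^sub>A * G (lam + 1) - K * exp (- r * T) * G lam else 0)"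
    by (auto simp: R_def algebra_simps)
  then show ?thesis
    using int neg_gamma_exponent_eq[OF assms(4,5)]
    by (simp add: equity_value_def val[unfolded P_def] Let_def k_def G_def P_def a_def)
qed

end
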